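(* Let $u_0\in\mathbb{R}$, let $p_0=\exp(-u_0)p^{\star}$, and for each small $\epsilon>0$ let $p^{\epsilon}$ be the solution of the multiscale problem described in the context, with $K^{\epsilon}$ chosen so that the homogenized coefficient associated with this family is $K_0=\exp(u_0)A$. Assume that the data $y$ is generated from noisy observations of the multiscale model: $$y_j=\ell_j(p^{\epsilon})+\xi_j,$$ where $\{\xi_j\}$ is an i.i.d. sequence of random variables distributed as $N(0,\gamma^2)$. Assume that the linear functionals $\ell_j$ are chosen so that $$\lim_{\epsilon\to0}\limsup_{N\to\infty}\frac1N\sum_{j=1}^N|\ell_j(p^{\epsilon}-p_0)|^2=0$$ and $$\liminf_{N\to\infty}\frac1N\sum_{j=1}^N\ell_j(p^{\star})^2\ge L>0.$$ Let $\overline{u}$ be the least squares estimator based on $y_1,\dots,y_N$ (see context). Then, $\xi$-almost surely, $$\lim_{\epsilon\to0}\lim_{N\to\infty}\left|\exp(-\overline{u})-\exp(-u_0)\right|=0.$$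
   Context: $D\subset\mathbb{R}^d$ is bounded and open, $f\in H^{-1}(D)$, and $A$ is a known constant symmetric positive-definite $d\times d$ matrix. $p^{\star}\in H^1_0(D)$ is the weak solution of $$\nabla\cdot v=f\ \text{ in }D,\qquad v=-A\nabla p^{\star},\qquad p^{\star}=0\ \text{ on }\partial D.$$ Thus for $u\in\mathbb{R}$ the solution of the same problem with $A$ replaced by $\exp(u)A$ is $\exp(-u)p^{\star}$; in particular $p_0$ is the solution for $u=u_0$. The $\ell_j:H^1(D)\to\mathbb{R}$, $j\ge1$, are continuous linear functionals, and $\gamma>0$. Multiscale problem: $K:D\times\mathbb{T}^d\to S^{d,+}$ takes values in the symmetric positive-definite $d\times d$ matrices, is periodic in its second argument ($\mathbb{T}^d$ the unit torus), and is bounded and uniformly positive-definite. With $K^{\epsilon}(x)=K(x,x/\epsilon)$, $p^{\epsilon}\in H^1_0(D)$ is the weak solution of $$\nabla\cdot v^{\epsilon}=f\ \text{ in }D,\qquad v^{\epsilon}=-K^{\epsilon}\nabla p^{\epsilon},\qquad p^{\epsilon}=0\ \text{ on }\partial D.$$ The homogenized coefficient of this family is $K_0(x)=\int_{\mathbb{T}^d}\left(K(x,y)+K(x,y)\nabla_y\chi(x,y)^T\right)dy$, where the vector field $\chi(x,\cdot)$ is the periodic solution (unique up to additive constants) of $-\nabla_y\cdot(\nabla_y\chi\,K^T)=\nabla_y\cdot K^T$ on $\mathbb{T}^d$, with $(\nabla_y\chi)_{ij}=\partial\chi_i/\partial y_j$ and $(\nabla_y\cdot M)_i=\sum_j\partial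 M_{ij}/\partial y_j$. The estimator $\overline{u}$ (depending on $N$, $\epsilon$ and the data) is the minimizer over $u\in\mathbb{R}$ of $$\Phi(u)=\frac{1}{2\gamma^2}\sum_{j=1}^N|y_j-\exp(-u)\ell_j(p^{\star})|^2,$$ and it satisfies $$\exp(-\overline{u})=\frac{\sum_{j=1}^Ny_j\,\ell_j(p^{\star})}{\sum_{j=1}^N\ell_j(p^{\star})^2}.$$
   Formalization: The inner limit as N→∞ is replaced by the limsup, because for fixed ε the limit need not exist under the stated assumptions (for example when the ℓ_j alternate between two functionals on ever longer blocks); where the inner limits exist the two claims agree. *)

theory Defs
  imports "HOL-Probability.Probability"
begin

section \<open>Test functions\<close>

definition partial_deriv :: "'d::finite \<Rightarrow> (real^'d \<Rightarrow> real) \<Rightarrow> real^'d \<Rightarrow> real" where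
  "partial_deriv i f x = frechet_derivative f (at x) (axis i 1)"

primrec Ck :: "nat \<Rightarrow> (real^'d::finite \<Rightarrow> real) \<Rightarrow> bool" where
  "Ck 0 f \<longleftrightarrow> continuous_on UNIV f"
| "Ck (Suc k) f \<longleftrightarrow> (\<forall>x. f differentiable (at x)) \<and> (\<forall>i. Ck k (partial_deriv i f))"

definition smooth :: "(real^'d::finite \<Rightarrow> real) \<Rightarrow> bool" where
  "smooth f \<longleftrightarrow> (\<forall>k. Ck k f)"

definition test_functions :: "(real^'d::finite) set \<Rightarrow> (real^'d \<Rightarrow> real) set" where
  "test_functions D =
     {\<phi>. smooth \<phi> \<and> compact (closure {x. \<phi> x \<noteq> 0}) \<and> closure {x. \<phi> x \<noteq> 0} \<subseteq> D}"

definition periodic :: "(real^'d::finite \<Rightarrow> 'b) \<Rightarrow> bool" where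
  "periodic f \<longleftrightarrow> (\<forall>y i. f (y + axis i 1) = f y)"

definition periodic_test_functions :: "(real^'d::finite \<Rightarrow> real) set" where
  "periodic_test_functions = {\<phi>. smooth \<phi> \<and> periodic \<phi>}"


section \<open>Sobolev spaces\<close>

text \<open>
  Elements of the function spaces are represented by functions rather than by classes modulo
  almost everywhere equality. The Sobolev norm does not see null sets, and a functional that is
  linear and bounded for it takes equal values on functions that agree almost everywhere.

  Weak gradients are taken relative to a measure \<open>\<mu>\<close> and a set \<open>T\<close> of test functions, so that a
  domain (compactly supported test functions) and the torus (unit cell with periodic test
  functions) are instances of the same notion.
\<close>

definition square_integrable :: "'a measure \<Rightarrow> ('a \<Rightarrow> 'b::euclidean_space) \<Rightarrow> bool" where
  "square_integrable \<mu> f \<longleftrightarrow>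
     f \<in> borel_measurable \<mu> \<and> integrable \<mu> (\<lambda>x. (norm (f x))\<^sup>2)"

definition has_weak_gradient ::
  "(real^'d::finite) measure \<Rightarrow> (real^'d \<Rightarrow> real) set \<Rightarrow> (real^'d \<Rightarrow> real) \<Rightarrow> (real^'d \<Rightarrow> real^'d) \<Rightarrow> bool"
where
  "has_weak_gradient \<mu> T f g \<longleftrightarrow> square_integrable \<mu> g \<and>
     (\<forall>\<phi>\<in>T. \<forall>i. (LINT x|\<mu>. f x * partial_deriv i \<phi> x) = - (LINT x|\<mu>. g x $ i * \<phi> x))"

definition weak_gradient ::
  "(real^'d::finite) measure \<Rightarrow> (real^'d \<Rightarrow> real) set \<Rightarrow> (real^'d \<Rightarrow> real) \<Rightarrow> real^'d \<Rightarrow> real^'d"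
where
  "weak_gradient \<mu> T f = (SOME g. has_weak_gradient \<mu> T f g)"

definition grad :: "(real^'d::finite) set \<Rightarrow> (real^'d \<Rightarrow> real) \<Rightarrow> real^'d \<Rightarrow> real^'d" where
  "grad D = weak_gradient (lebesgue_on D) (test_functions D)"

definition H1 :: "(real^'d::finite) set \<Rightarrow> (real^'d \<Rightarrow> real) set" where
  "H1 D = {f. square_integrable (lebesgue_on D) f \<and>
     (\<exists>g. has_weak_gradient (lebesgue_on D) (test_functions D) f g)}"

definition H1_norm :: "(real^'d::finite) set \<Rightarrow> (real^'d \<Rightarrow> real) \<Rightarrow> real" where
  "H1_norm D f = sqrt ((LINT x|lebesgue_on D. (f x)\<^sup>2) + (LINT x|lebesgue_on D. (norm (grad D f x))\<^sup>2))"

definition H10 :: "(real^'d::finite) set \<Rightarrow> (real^'d \<Rightarrow> real) set" where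
  "H10 D = {f \<in> H1 D. \<forall>e>0. \<exists>\<phi>\<in>test_functions D. H1_norm D (\<lambda>x. f x - \<phi> x) < e}"

definition continuous_functional ::
  "(real^'d::finite) set \<Rightarrow> (real^'d \<Rightarrow> real) set \<Rightarrow> ((real^'d \<Rightarrow> real) \<Rightarrow> real) \<Rightarrow> bool"
where
  "continuous_functional D V F \<longleftrightarrow>
     (\<forall>f\<in>V. \<forall>g\<in>V. \<forall>a b. F (\<lambda>x. a * f x + b * g x) = a * F f + b * F g) \<and>
     (\<exists>C. \<forall>f\<in>V. \<bar>F f\<bar> \<le> C * H1_norm D f)"

definition H_minus_1 :: "(real^'d::finite) set \<Rightarrow> ((real^'d \<Rightarrow> real) \<Rightarrow> real) set" where
  "H_minus_1 D = {F. continuous_functional D (H10 D) F}"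


section \<open>Elliptic problem\<close>

definition sym_pos_def :: "real^'d^'d::finite \<Rightarrow> bool" where
  "sym_pos_def A \<longleftrightarrow> transpose A = A \<and> (\<forall>z. z \<noteq> 0 \<longrightarrow> z \<bullet> (A *v z) > 0)"

text \<open>
  The divergence is distributional: \<open>\<nabla> \<cdot> v\<close> acts on \<open>\<phi>\<close> as \<open>- \<integral> v \<cdot> \<nabla>\<phi>\<close>.
\<close>

definition weak_solution ::
  "(real^'d::finite) set \<Rightarrow> (real^'d \<Rightarrow> real^'d^'d) \<Rightarrow> ((real^'d \<Rightarrow> real) \<Rightarrow> real) \<Rightarrow> (real^'d \<Rightarrow> real) \<Rightarrow> bool"
where
  "weak_solution D K f p \<longleftrightarrow> p \<in> H10 D \<and>
     (let v = (\<lambda>x. - (K x *v grad D p x)) in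
       \<forall>\<phi>\<in>H10 D. - (LINT x|lebesgue_on D. v x \<bullet> grad D \<phi> x) = f \<phi>)"


section \<open>Periodic homogenization\<close>

abbreviation unit_cell :: "(real^'d::finite) measure" where
  "unit_cell \<equiv> lebesgue_on (cbox 0 One)"

definition torus_grad :: "(real^'d::finite \<Rightarrow> real) \<Rightarrow> real^'d \<Rightarrow> real^'d" where
  "torus_grad = weak_gradient unit_cell periodic_test_functions"

definition H1_torus :: "(real^'d::finite \<Rightarrow> real) set" where
  "H1_torus = {f. periodic f \<and> square_integrable unit_cell f \<and>
     (\<exists>g. has_weak_gradient unit_cell periodic_test_functions f g)}"

definition torus_jacobian :: "(real^'d::finite \<Rightarrow> real^'d) \<Rightarrow> real^'d \<Rightarrow> real^'d^'d" where
  "torus_jacobian w y = (\<chi> i. torus_grad (\<lambda>z. w z $ i) y)"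

text \<open>
  Weak form of \<open>- \<nabla> \<cdot> (\<nabla>w K\<^sup>T) = \<nabla> \<cdot> K\<^sup>T\<close> on the torus, the divergence of a matrix field being
  taken row by row.
\<close>

definition cell_solution :: "(real^'d::finite \<Rightarrow> real^'d^'d) \<Rightarrow> (real^'d \<Rightarrow> real^'d) \<Rightarrow> bool" where
  "cell_solution K w \<longleftrightarrow>
     (\<forall>i. (\<lambda>y. w y $ i) \<in> H1_torus) \<and>
     (\<forall>i. \<forall>\<phi>\<in>H1_torus.
        (LINT y|unit_cell. (torus_jacobian w y ** transpose (K y)) $ i \<bullet> torus_grad \<phi> y) =
        - (LINT y|unit_cell. transpose (K y) $ i \<bullet> torus_grad \<phi> y))"

definition homogenized_coefficient ::
  "(real^'d::finite \<Rightarrow> real^'d \<Rightarrow> real^'d^'d) \<Rightarrow> real^'d \<Rightarrow> real^'d^'d \<Rightarrow> bool"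
where
  "homogenized_coefficient K x B \<longleftrightarrow> (\<exists>w. cell_solution (K x) w \<and>
     B = (LINT y|unit_cell. K x y + K x y ** transpose (torus_jacobian w y)))"

text \<open>
  The two measurability conditions are what the cell problem and the problem with coefficient
  \<open>K x (x / \<epsilon>)\<close> need in order to be meaningful; joint measurability is not required.
\<close>

definition multiscale_coefficient ::
  "(real^'d::finite) set \<Rightarrow> (real^'d \<Rightarrow> real^'d \<Rightarrow> real^'d^'d) \<Rightarrow> bool"
where
  "multiscale_coefficient D K \<longleftrightarrow>
     (\<forall>x\<in>D. periodic (K x)) \<and>
     (\<forall>x\<in>D. \<forall>y. sym_pos_def (K x y)) \<and>
     (\<exists>\<beta>. \<forall>x\<in>D. \<forall>y. norm (K x y) \<le> \<beta>) \<and>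
     (\<exists>\<alpha>>0. \<forall>x\<in>D. \<forall>y z. \<alpha> * (norm z)\<^sup>2 \<le> z \<bullet> (K x y *v z)) \<and>
     (\<forall>x\<in>D. K x \<in> borel_measurable lebesgue) \<and>
     (\<forall>\<epsilon>>0. (\<lambda>x. K x (x /\<^sub>R \<epsilon>)) \<in> borel_measurable (lebesgue_on D))"


section \<open>Least squares estimator\<close>

definition lsq_misfit :: "real \<Rightarrow> nat \<Rightarrow> (nat \<Rightarrow> real) \<Rightarrow> (nat \<Rightarrow> real) \<Rightarrow> real \<Rightarrow> real" where
  "lsq_misfit \<gamma> N y a u = 1 / (2 * \<gamma>\<^sup>2) * (\<Sum>j=1..N. \<bar>y j - exp (- u) * a j\<bar>\<^sup>2)"

text \<open>
  The misfit has a minimizer only if \<open>\<Sum>j=1..N. y j * a j\<close> is positive or all \<open>a j\<close> vanish;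
  otherwise the estimator has an unspecified value.
\<close>

definition lsq_estimator :: "real \<Rightarrow> nat \<Rightarrow> (nat \<Rightarrow> real) \<Rightarrow> (nat \<Rightarrow> real) \<Rightarrow> real" where
  "lsq_estimator \<gamma> N y a = arg_min (lsq_misfit \<gamma> N y a) (\<lambda>_. True)"

end

theory Submission
  imports Defs
begin

text \<open>
  The underlying problem is a linear regression with one unknown coefficient. Write
  \<open>a\<^sub>j = \<ell>\<^sub>j(p\<^sup>\<star>)\<close>, \<open>c = exp(-u\<^sub>0)\<close>, \<open>d\<^sub>j = \<ell>\<^sub>j(p\<^sup>\<epsilon> - p\<^sub>0)\<close> and \<open>S\<^sub>N = \<Sum>\<^sub>j a\<^sub>j\<^sup>2\<close>. As
  \<open>p\<^sub>0 = c p\<^sup>\<star>\<close> and \<open>\<ell>\<^sub>j\<close> is linear, the data are \<open>y\<^sub>j = c a\<^sub>j + d\<^sub>j + \<xi>\<^sub>j\<close>, so that the regression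
  coefficient satisfies
  \<open>(\<Sum>\<^sub>j y\<^sub>j a\<^sub>j) / S\<^sub>N = c + (\<Sum>\<^sub>j d\<^sub>j a\<^sub>j) / S\<^sub>N + (\<Sum>\<^sub>j a\<^sub>j \<xi>\<^sub>j) / S\<^sub>N\<close>.

  The model error, i.e. the second term, is by Cauchy--Schwarz at most the
  square root of \<open>(\<Sum>\<^sub>j d\<^sub>j\<^sup>2) / S\<^sub>N\<close> in absolute value, which the two assumptions on the functionals
  make small for large \<open>N\<close> once \<open>\<epsilon>\<close> is small (\<open>weighted_mean_small\<close>).

  The noise, i.e. the third term, is a centred Gaussian of variance \<open>\<gamma>\<^sup>2 / S\<^sub>N = O(1/N)\<close>. Its fourth
  moment is \<open>O(1/N\<^sup>2)\<close>, hence summable, so the term tends to \<open>0\<close> almost surely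
  (\<open>weighted_normal_mean_AE_tendsto_0\<close>). The noise does not depend on \<open>\<epsilon>\<close>, and therefore one null
  set serves all \<open>\<epsilon>\<close>; this is what permits the limit \<open>\<epsilon> \<rightarrow> 0\<close> over an uncountable set of parameters
  inside the almost sure statement.

  Once the two errors together are below \<open>c > 0\<close>, the regression coefficient is positive. It then
  has the form \<open>exp(-u)\<close>, and the unique such \<open>u\<close> is the least squares estimator
  (\<open>exp_lsq_estimator\<close>).
\<close>

text \<open>
  Completing the square: with \<open>S = \<Sum>\<^sub>j a\<^sub>j\<^sup>2\<close> and \<open>r = (\<Sum>\<^sub>j y\<^sub>j a\<^sub>j) / S\<close>, the misfit at \<open>u\<close> exceeds the
  misfit at \<open>- ln r\<close> by \<open>S / (2 \<gamma>\<^sup>2) (exp(-u) - r)\<^sup>2\<close>. The minimizer \<open>- ln r\<close> exists only for \<open>r > 0\<close>.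
\<close>

lemma exp_lsq_estimator:
  assumes \<gamma>: "\<gamma> \<noteq> 0"
    and pos: "(\<Sum>j=1..N. y j * a j) > 0"
  shows "exp (- lsq_estimator \<gamma> N y a) = (\<Sum>j=1..N. y j * a j) / (\<Sum>j=1..N. (a j)\<^sup>2)"
proof -
  define S where "S = (\<Sum>j=1..N. (a j)\<^sup>2)"
  define B where "B = (\<Sum>j=1..N. y j * a j)"
  define Y where "Y = (\<Sum>j=1..N. (y j)\<^sup>2)"
  define F where "F = lsq_misfit \<gamma> N y a"
  have "S \<noteq> 0"
  proof
    assume "S = 0"
    then have "\<forall>j\<in>{1..N}. (a j)\<^sup>2 = 0"
      unfolding S_def by (subst (asm) sum_nonneg_eq_0_iff) auto
    then show False using pos by simp
  qed
  moreover have "S \<ge> 0" unfolding S_def by (rule sum_nonneg) simp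
  ultimately have S: "S > 0" by simp
  have B: "B > 0" using pos by (simp add: B_def)
  have expand: "(\<Sum>j=1..N. \<bar>y j - t * a j\<bar>\<^sup>2) = Y - 2 * t * B + t\<^sup>2 * S" for t
    unfolding Y_def B_def S_def
    by (simp add: power2_diff sum.distrib sum_subtractf sum_distrib_left power_mult_distrib
        algebra_simps)
  define v where "v = - ln (B / S)"
  have expv: "exp (- v) = B / S" using S B by (simp add: v_def)
  have square: "F u = F v + S / (2 * \<gamma>\<^sup>2) * (exp (- u) - B / S)\<^sup>2" for u
    unfolding F_def lsq_misfit_def expand expv using S \<gamma>
    by (simp add: field_simps power2_eq_square)
  have "F (arg_min F (\<lambda>_. True)) = F v"
  proof (rule arg_min_equality)
    show "F v \<le> F u" for u using S by (subst square[of u]) simp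
  qed simp
  with square[of "arg_min F (\<lambda>_. True)"] S \<gamma>
  show ?thesis by (simp add: lsq_estimator_def F_def B_def S_def)
qed

text \<open>The Borel--Cantelli argument in the form in which moment bounds enter it.\<close>

lemma (in prob_space) AE_tendsto_0_if_summable_expectation:
  fixes Z :: "nat \<Rightarrow> 'a \<Rightarrow> real"
  assumes int: "\<And>n. integrable M (Z n)"
    and nonneg: "\<And>n \<omega>. 0 \<le> Z n \<omega>"
    and summable: "summable (\<lambda>n. expectation (Z n))"
  shows "AE \<omega> in M. (\<lambda>n. Z n \<omega>) \<longlonglongrightarrow> 0"
proof -
  have meas [measurable]: "\<And>n. Z n \<in> borel_measurable M" using int by auto
  have "(\<integral>\<^sup>+\<omega>. (\<Sum>n. ennreal (Z n \<omega>)) \<partial>M) = (\<Sum>n. \<integral>\<^sup>+\<omega>. ennreal (Z n \<omega>) \<partial>M)"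
    by (rule nn_integral_suminf) simp
  also have "\<dots> = (\<Sum>n. ennreal (expectation (Z n)))"
    using int nonneg by (simp add: nn_integral_eq_integral)
  also have "\<dots> \<noteq> \<infinity>"
    by (subst suminf_ennreal2[OF _ summable]) (simp_all add: nonneg integral_nonneg_AE)
  finally have "AE \<omega> in M. (\<Sum>n. ennreal (Z n \<omega>)) \<noteq> \<infinity>"
    by (intro nn_integral_PInf_AE) auto
  then show ?thesis
    by eventually_elim (use nonneg in \<open>auto intro!: summable_LIMSEQ_zero summable_suminf_not_top\<close>)
qed

lemma (in prob_space) weighted_sum_normal_distributed:
  fixes \<xi> :: "nat \<Rightarrow> 'a \<Rightarrow> real"
  assumes J: "finite J"
    and indep: "indep_vars (\<lambda>_. borel) \<xi> J"
    and normal: "\<And>j. j \<in> J \<Longrightarrow> distributed M lborel (\<xi> j) (normal_density 0 \<gamma>)"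
    and \<gamma>: "\<gamma> > 0"
    and S: "(\<Sum>j\<in>J. (a j)\<^sup>2) > 0"
  shows "distributed M lborel (\<lambda>\<omega>. \<Sum>j\<in>J. a j * \<xi> j \<omega>)
           (normal_density 0 (\<gamma> * sqrt (\<Sum>j\<in>J. (a j)\<^sup>2)))"
proof -
  \<comment> \<open>A term with weight \<open>0\<close> has no density, so the sum is taken over the other indices.\<close>
  define I where "I = {j\<in>J. a j \<noteq> 0}"
  have I: "finite I" "I \<subseteq> J" using J by (auto simp: I_def)
  have sum_I: "(\<Sum>j\<in>J. g j) = (\<Sum>j\<in>I. g j)" if "\<And>j. a j = 0 \<Longrightarrow> g j = 0" for g :: "nat \<Rightarrow> real"
    using J that by (intro sum.mono_neutral_right) (auto simp: I_def)
  have "I \<noteq> {}" using S sum_I[of "\<lambda>j. (a j)\<^sup>2"] by auto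
  have "distributed M lborel (\<lambda>\<omega>. \<Sum>j\<in>I. a j * \<xi> j \<omega>)
          (normal_density (\<Sum>j\<in>I. 0) (sqrt (\<Sum>j\<in>I. (\<bar>a j\<bar> * \<gamma>)\<^sup>2)))"
  proof (rule sum_indep_normal[OF I(1) \<open>I \<noteq> {}\<close>])
    show "indep_vars (\<lambda>_. borel) (\<lambda>j \<omega>. a j * \<xi> j \<omega>) I"
      using indep_vars_subset[OF indep I(2)] by (rule indep_vars_compose2) auto
    show "0 < \<bar>a j\<bar> * \<gamma>" if "j \<in> I" for j using that \<gamma> by (simp add: I_def)
    show "distributed M lborel (\<lambda>\<omega>. a j * \<xi> j \<omega>) (normal_density 0 (\<bar>a j\<bar> * \<gamma>))" if "j \<in> I" for j
      using normal_density_affine[OF normal[of j] \<gamma>, of "a j" 0] that by (auto simp: I_def)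
  qed
  moreover have "sqrt (\<Sum>j\<in>I. (\<bar>a j\<bar> * \<gamma>)\<^sup>2) = \<gamma> * sqrt (\<Sum>j\<in>J. (a j)\<^sup>2)"
    using \<gamma> by (simp add: sum_I power_mult_distrib sum_distrib_right[symmetric] real_sqrt_mult)
  ultimately show ?thesis by (simp add: sum_I)
qed

lemma (in prob_space) normal_fourth_moment:
  assumes X: "distributed M lborel X (normal_density 0 \<sigma>)" and \<sigma>: "\<sigma> > 0"
  shows "integrable M (\<lambda>\<omega>. X \<omega> ^ 4)" and "expectation (\<lambda>\<omega>. X \<omega> ^ 4) = 3 * \<sigma> ^ 4"
proof -
  have moment: "has_bochner_integral lborel (\<lambda>x. normal_density 0 \<sigma> x * x ^ 4) (3 * \<sigma> ^ 4)"
    using normal_moment_even[OF \<sigma>, of 0 2] \<sigma>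
    by (simp add: fact_numeral field_simps power2_eq_square eval_nat_numeral)
  show "integrable M (\<lambda>\<omega>. X \<omega> ^ 4)"
    using distributed_integrable[OF X, of "\<lambda>x. x ^ 4"] moment
    by (auto simp: has_bochner_integral_iff)
  show "expectation (\<lambda>\<omega>. X \<omega> ^ 4) = 3 * \<sigma> ^ 4"
    using distributed_integral[OF X, of "\<lambda>x. x ^ 4"] moment
    by (auto simp: has_bochner_integral_iff)
qed

text \<open>
  A strong law with weights about which nothing but \<open>\<Sum>\<^sub>j a\<^sub>j\<^sup>2 \<ge> m N\<close> is known. The variance of the
  quotient is only \<open>O(1/N)\<close>, which is not summable; the fourth moment is used since it is
  proportional to the square of the variance.
\<close>

lemma (in prob_space) weighted_normal_mean_AE_tendsto_0:
  fixes \<xi> :: "nat \<Rightarrow> 'a \<Rightarrow> real"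
  assumes indep: "indep_vars (\<lambda>_. borel) \<xi> {1..}"
    and normal: "\<And>j. j \<ge> 1 \<Longrightarrow> distributed M lborel (\<xi> j) (normal_density 0 \<gamma>)"
    and \<gamma>: "\<gamma> > 0"
    and m: "m > 0"
    and growth: "\<forall>\<^sub>F N in sequentially. m * real N \<le> (\<Sum>j=1..N. (a j)\<^sup>2)"
  shows "AE \<omega> in M. (\<lambda>N. (\<Sum>j=1..N. a j * \<xi> j \<omega>) / (\<Sum>j=1..N. (a j)\<^sup>2)) \<longlonglongrightarrow> 0"
proof -
  define S where "S = (\<lambda>N. \<Sum>j=1..N. (a j)\<^sup>2)"
  define Q where "Q = (\<lambda>N \<omega>. (\<Sum>j=1..N. a j * \<xi> j \<omega>) / S N)"
  obtain N0 where N0: "\<And>N. N \<ge> N0 \<Longrightarrow> m * real N \<le> S N"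
    using growth by (auto simp: eventually_sequentially S_def)
  define k where "k = Suc N0"
  have lower: "m * real (Suc n) \<le> S (n + k)" for n
  proof -
    have "m * real (Suc n) \<le> m * real (n + k)" using m by (simp add: k_def)
    also have "\<dots> \<le> S (n + k)" by (rule N0) (simp add: k_def)
    finally show ?thesis .
  qed
  have S_pos: "S (n + k) > 0" for n
    by (rule less_le_trans[OF _ lower]) (use m in simp)
  have moment: "integrable M (\<lambda>\<omega>. Q (n + k) \<omega> ^ 4) \<and>
      expectation (\<lambda>\<omega>. Q (n + k) \<omega> ^ 4) = 3 * \<gamma> ^ 4 / (S (n + k))\<^sup>2" for n
  proof -
    let ?J = "{1..n + k}" and ?X = "\<lambda>\<omega>. \<Sum>j=1..n + k. a j * \<xi> j \<omega>"
    have "distributed M lborel ?X (normal_density 0 (\<gamma> * sqrt (\<Sum>j\<in>?J. (a j)\<^sup>2)))"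
      by (rule weighted_sum_normal_distributed)
        (use indep_vars_subset[OF indep] normal \<gamma> S_pos[of n] in \<open>auto simp: S_def\<close>)
    then have X: "distributed M lborel ?X (normal_density 0 (\<gamma> * sqrt (S (n + k))))"
      by (simp add: S_def)
    have "\<gamma> * sqrt (S (n + k)) > 0" using \<gamma> S_pos[of n] by simp
    note fourth = normal_fourth_moment[OF X this]
    have "(sqrt (S (n + k))) ^ 4 = (S (n + k))\<^sup>2"
      using S_pos[of n] power_mult[of "sqrt (S (n + k))" 2 2] by simp
    then have "expectation (\<lambda>\<omega>. ?X \<omega> ^ 4) = 3 * \<gamma> ^ 4 * (S (n + k))\<^sup>2"
      using fourth(2) by (simp add: power_mult_distrib)
    moreover have "3 * \<gamma> ^ 4 * (S (n + k))\<^sup>2 / S (n + k) ^ 4 = 3 * \<gamma> ^ 4 / (S (n + k))\<^sup>2"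
      using S_pos[of n] by (simp add: field_simps power_add[symmetric])
    ultimately show ?thesis
      using fourth(1) by (simp add: Q_def power_divide)
  qed
  have "summable (\<lambda>n. expectation (\<lambda>\<omega>. Q (n + k) \<omega> ^ 4))"
  proof (rule summable_comparison_test')
    show "summable (\<lambda>n. 3 * \<gamma> ^ 4 / m\<^sup>2 * (1 / real (Suc n) ^ 2))"
      using inverse_squares_sums by (intro summable_mult) (auto simp: sums_iff)
    show "norm (expectation (\<lambda>\<omega>. Q (n + k) \<omega> ^ 4)) \<le> 3 * \<gamma> ^ 4 / m\<^sup>2 * (1 / real (Suc n) ^ 2)"
      for n
    proof -
      have "3 * \<gamma> ^ 4 / (S (n + k))\<^sup>2 \<le> 3 * \<gamma> ^ 4 / (m * real (Suc n))\<^sup>2"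
        using m \<gamma> lower[of n] S_pos[of n] by (intro divide_left_mono power_mono mult_pos_pos) auto
      then show ?thesis using moment[of n] \<gamma> by (simp add: power_mult_distrib)
    qed
  qed
  then have "AE \<omega> in M. (\<lambda>n. Q (n + k) \<omega> ^ 4) \<longlonglongrightarrow> 0"
    using moment by (intro AE_tendsto_0_if_summable_expectation) auto
  then show ?thesis
  proof eventually_elim
    case (elim \<omega>)
    then have "(\<lambda>n. Q (n + k) \<omega>) \<longlonglongrightarrow> 0" by (simp add: power_tendsto_0_iff)
    then show ?case unfolding Q_def S_def by (rule LIMSEQ_offset)
  qed
qed

lemma weighted_mean_small:
  fixes d a :: "nat \<Rightarrow> real"
  assumes m: "m > 0" and \<delta>: "\<delta> > 0" and N: "N > 0"
    and a: "m \<le> 1 / real N * (\<Sum>j=1..N. (a j)\<^sup>2)"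
    and d: "1 / real N * (\<Sum>j=1..N. (d j)\<^sup>2) < m * \<delta>\<^sup>2"
  shows "\<bar>(\<Sum>j=1..N. d j * a j) / (\<Sum>j=1..N. (a j)\<^sup>2)\<bar> < \<delta>"
proof -
  let ?S = "\<Sum>j=1..N. (a j)\<^sup>2" and ?T = "\<Sum>j=1..N. (d j)\<^sup>2"
  have S: "?S \<ge> m * real N" using a N by (simp add: field_simps)
  then have S_pos: "?S > 0" using m N by (smt (verit) mult_pos_pos of_nat_0_less_iff)
  have "?T < m * real N * \<delta>\<^sup>2" using d N by (simp add: field_simps)
  also have "\<dots> \<le> ?S * \<delta>\<^sup>2" using S by (intro mult_right_mono) auto
  finally have T: "?T < ?S * \<delta>\<^sup>2" .
  have "(\<Sum>j=1..N. d j * a j)\<^sup>2 \<le> ?T * ?S" by (rule Cauchy_Schwarz_ineq_sum)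
  also have "\<dots> < (?S * \<delta>\<^sup>2) * ?S" using T S_pos by (rule mult_strict_right_mono)
  also have "\<dots> = (\<delta> * ?S)\<^sup>2" by (simp add: power2_eq_square algebra_simps)
  finally have "\<bar>\<Sum>j=1..N. d j * a j\<bar> < \<delta> * ?S"
    using abs_le_square_iff[of "\<delta> * ?S" "\<Sum>j=1..N. d j * a j"] \<delta> S_pos by simp
  then show ?thesis using S_pos by (simp add: abs_divide divide_less_eq)
qed

theorem theorem12:
  fixes D :: "(real^'d::finite) set"
    and f :: "(real^'d \<Rightarrow> real) \<Rightarrow> real"
    and A :: "real^'d^'d"
    and pstar p0 :: "real^'d \<Rightarrow> real"
    and K :: "real^'d \<Rightarrow> real^'d \<Rightarrow> real^'d^'d"
    and p :: "real \<Rightarrow> real^'d \<Rightarrow> real"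
    and l :: "nat \<Rightarrow> (real^'d \<Rightarrow> real) \<Rightarrow> real"
    and u0 \<gamma> L :: real
    and M :: "'w measure"
    and \<xi> :: "nat \<Rightarrow> 'w \<Rightarrow> real"
    and y :: "real \<Rightarrow> 'w \<Rightarrow> nat \<Rightarrow> real"
    and ubar :: "real \<Rightarrow> nat \<Rightarrow> 'w \<Rightarrow> real"
  assumes D: "bounded D" "open D"
    and f: "f \<in> H_minus_1 D"
    and A: "sym_pos_def A"
    and pstar: "weak_solution D (\<lambda>x. A) f pstar"
    and p0: "p0 = (\<lambda>x. exp (- u0) * pstar x)"
    and l: "\<forall>j\<ge>1. continuous_functional D (H1 D) (l j)"
    and \<gamma>: "\<gamma> > 0"
    and K: "multiscale_coefficient D K"
    and K0: "\<forall>x\<in>D. homogenized_coefficient K x (exp u0 *\<^sub>R A)"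
    and p: "\<forall>\<^sub>F \<epsilon> in at_right 0. weak_solution D (\<lambda>x. K x (x /\<^sub>R \<epsilon>)) f (p \<epsilon>)"
    and M: "prob_space M"
    and \<xi>_indep: "prob_space.indep_vars M (\<lambda>_. borel) \<xi> {1..}"
    and \<xi>_normal: "\<forall>j\<ge>1. distributed M lborel (\<xi> j) (normal_density 0 \<gamma>)"
    and y: "\<forall>\<epsilon> \<omega> j. y \<epsilon> \<omega> j = l j (p \<epsilon>) + \<xi> j \<omega>"
    and l_conv: "((\<lambda>\<epsilon>. limsup (\<lambda>N. ereal (1 / real N * (\<Sum>j=1..N. \<bar>l j (\<lambda>x. p \<epsilon> x - p0 x)\<bar>\<^sup>2))))
                   \<longlongrightarrow> 0) (at_right 0)"
    and l_lower: "liminf (\<lambda>N. ereal (1 / real N * (\<Sum>j=1..N. (l j pstar)\<^sup>2))) \<ge> ereal L"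
    and L: "L > 0"
    and ubar: "\<forall>\<epsilon> N \<omega>. ubar \<epsilon> N \<omega> = lsq_estimator \<gamma> N (y \<epsilon> \<omega>) (\<lambda>j. l j pstar)"
  shows "AE \<omega> in M.
           ((\<lambda>\<epsilon>. limsup (\<lambda>N. ereal \<bar>exp (- ubar \<epsilon> N \<omega>) - exp (- u0)\<bar>)) \<longlongrightarrow> 0) (at_right 0)"
proof -
  interpret prob_space M by (rule M)
  define c where "c = exp (- u0)"
  define a where "a = (\<lambda>j. l j pstar)"
  define m where "m = L / 2"
  have c: "c > 0" and m: "m > 0" using L by (auto simp: c_def m_def)
  have "ereal m < ereal L" using L by (simp add: m_def)
  then have "\<forall>\<^sub>F N in sequentially. ereal m < ereal (1 / real N * (\<Sum>j=1..N. (a j)\<^sup>2))"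
    unfolding a_def by (intro less_LiminfD) (rule less_le_trans[OF _ l_lower])
  then have a_lower: "\<forall>\<^sub>F N in sequentially. m < 1 / real N * (\<Sum>j=1..N. (a j)\<^sup>2)" by simp
  have growth: "\<forall>\<^sub>F N in sequentially. m * real N \<le> (\<Sum>j=1..N. (a j)\<^sup>2)"
    using a_lower eventually_gt_at_top[of 0] by eventually_elim (simp add: field_simps)
  have "AE \<omega> in M. (\<lambda>N. (\<Sum>j=1..N. a j * \<xi> j \<omega>) / (\<Sum>j=1..N. (a j)\<^sup>2)) \<longlonglongrightarrow> 0"
    using \<xi>_normal by (intro weighted_normal_mean_AE_tendsto_0[OF \<xi>_indep _ \<gamma> m growth]) auto
  then show ?thesis
  proof eventually_elim
    case (elim \<omega>)
    let ?S = "\<lambda>N. \<Sum>j=1..N. (a j)\<^sup>2"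
    let ?err = "\<lambda>\<epsilon>. limsup (\<lambda>N. ereal \<bar>exp (- ubar \<epsilon> N \<omega>) - exp (- u0)\<bar>)"
    have small: "\<forall>\<^sub>F \<epsilon> in at_right 0. ?err \<epsilon> \<le> ereal e" if e: "e > 0" for e
    proof -
      \<comment> \<open>Model error and noise each contribute at most \<open>\<delta>\<close>; their sum must stay below \<open>e\<close> and also
        below \<open>c\<close>, to keep the regression coefficient positive.\<close>
      define \<delta> where "\<delta> = min e c / 3"
      have \<delta>: "\<delta> > 0" "2 * \<delta> < e" "2 * \<delta> < c" using e c by (auto simp: \<delta>_def min_def)
      have "0 < ereal (m * \<delta>\<^sup>2)" using m \<delta> by simp
      from order_tendstoD(2)[OF l_conv this] p
      show ?thesis
      proof eventually_elim
        case (elim \<epsilon>)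
        define d where "d = (\<lambda>j. l j (\<lambda>x. p \<epsilon> x - p0 x))"
        have H1: "p \<epsilon> \<in> H1 D" "pstar \<in> H1 D"
          using elim(2) pstar by (auto simp: weak_solution_def H10_def)
        have y_eq: "y \<epsilon> \<omega> j = c * a j + d j + \<xi> j \<omega>" if "j \<ge> 1" for j
        proof -
          have "l j (\<lambda>x. 1 * p \<epsilon> x + (- c) * pstar x) = 1 * l j (p \<epsilon>) + (- c) * l j pstar"
            using l that H1 unfolding continuous_functional_def by blast
          then show ?thesis using y by (simp add: d_def a_def p0 c_def)
        qed
        have "\<forall>\<^sub>F N in sequentially. 1 / real N * (\<Sum>j=1..N. (d j)\<^sup>2) < m * \<delta>\<^sup>2"
          using Limsup_lessD[OF elim(1)] by (simp add: d_def)
        moreover have "\<forall>\<^sub>F N in sequentially. \<bar>(\<Sum>j=1..N. a j * \<xi> j \<omega>) / ?S N\<bar> < \<delta>"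
          using tendstoD[OF \<open>(\<lambda>N. (\<Sum>j=1..N. a j * \<xi> j \<omega>) / ?S N) \<longlonglongrightarrow> 0\<close> \<delta>(1)]
          by (simp add: dist_real_def)
        ultimately have "\<forall>\<^sub>F N in sequentially. ereal \<bar>exp (- ubar \<epsilon> N \<omega>) - exp (- u0)\<bar> \<le> ereal e"
          using a_lower eventually_gt_at_top[of 0]
        proof eventually_elim
          case (elim N)
          let ?B = "\<Sum>j=1..N. y \<epsilon> \<omega> j * a j"
          have "m * real N < ?S N" using elim by (simp add: field_simps)
          then have S: "?S N > 0" using m elim by (smt (verit) mult_pos_pos of_nat_0_less_iff)
          have "?B = (\<Sum>j=1..N. c * (a j)\<^sup>2 + d j * a j + a j * \<xi> j \<omega>)"
            by (rule sum.cong) (auto simp: y_eq power2_eq_square algebra_simps)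
          also have "\<dots> = c * ?S N + (\<Sum>j=1..N. d j * a j) + (\<Sum>j=1..N. a j * \<xi> j \<omega>)"
            by (simp add: sum.distrib sum_distrib_left)
          finally have ratio: "?B / ?S N =
              c + (\<Sum>j=1..N. d j * a j) / ?S N + (\<Sum>j=1..N. a j * \<xi> j \<omega>) / ?S N"
            using S by (simp add: add_divide_distrib)
          have "\<bar>(\<Sum>j=1..N. d j * a j) / ?S N\<bar> < \<delta>"
            by (rule weighted_mean_small[OF m \<delta>(1)]) (use elim in auto)
          with elim ratio have close: "\<bar>?B / ?S N - c\<bar> < 2 * \<delta>" by linarith
          then have "?B / ?S N > 0" using \<delta> by linarith
          then have "?B > 0" using S by (simp add: zero_less_divide_iff)
          then have "exp (- ubar \<epsilon> N \<omega>) = ?B / ?S N"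
            using exp_lsq_estimator[of \<gamma> "y \<epsilon> \<omega>" a N] \<gamma> ubar by (simp add: a_def)
          then show ?case using close \<delta> by (simp add: c_def)
        qed
        then show ?case by (rule Limsup_bounded)
      qed
    qed
    show ?case
    proof (rule order_tendstoI)
      fix b :: ereal assume "b < 0"
      moreover have "0 \<le> ?err \<epsilon>" for \<epsilon> by (rule le_Limsup) auto
      ultimately show "\<forall>\<^sub>F \<epsilon> in at_right 0. b < ?err \<epsilon>"
        by (intro always_eventually allI) (rule less_le_trans)
    next
      fix b :: ereal assume "0 < b"
      then obtain e where e: "0 < ereal e" "ereal e < b"
        using ereal_dense2[of 0 b] by auto
      from small[of e] e(1) have "\<forall>\<^sub>F \<epsilon> in at_right 0. ?err \<epsilon> \<le> ereal e" by simp
      then show "\<forall>\<^sub>F \<epsilon> in at_right 0. ?err \<epsilon> < b"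
        by eventually_elim (rule le_less_trans[OF _ e(2)])
    qed
  qed
qed

end
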